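(* Let $A, B \in \Gamma_\theta$ and write $A = \begin{pmatrix} * & * \\ c_A & *\end{pmatrix}$, $B = \begin{pmatrix} * & * \\ c_B & *\end{pmatrix}$, $AB = \begin{pmatrix} * & * \\ c_{AB} & *\end{pmatrix}$. Then $$\mathfrak{S}(AB) - \mathfrak{S}(A) - \mathfrak{S}(B) = -\mathrm{sign}(c_A c_B c_{AB}).$$
   Context: $\Gamma_\theta = \{\begin{pmatrix} a&b\\c&d\end{pmatrix}\in \mathrm{SL}_2(\mathbf{Z}) : a\equiv d,\ b\equiv c \pmod 2\}$. For $A=\begin{pmatrix} a&b\\c&d\end{pmatrix}\in\Gamma_\theta$, $\mathfrak{S}(A)=\sum_{k=1}^{|c|-1}(-1)^{\lfloor ka/c\rfloor+k+1}$ if $c\neq 0$, and $\mathfrak{S}(A)=0$ if $c=0$. The sign function satisfies $\mathrm{sign}(0)=0$. *)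

theory Defs
  imports "HOL-Analysis.Analysis" "HOL-Number_Theory.Cong"
begin

definition Gamma_theta :: "(int ^ 2 ^ 2) set" where
  "Gamma_theta =
     {A. det A = 1 \<and> [A $ 1 $ 1 = A $ 2 $ 2] (mod 2) \<and> [A $ 1 $ 2 = A $ 2 $ 1] (mod 2)}"

(* The power (-1)^n for an integer exponent n, which may be negative; the operator powi is not
   available on int because it requires inverses. *)
definition neg_one_power :: "int \<Rightarrow> int" where
  "neg_one_power n = (if even n then 1 else -1)"

lemma of_int_neg_one_power: "real_of_int (neg_one_power n) = (-1) powi n"
  by (simp add: neg_one_power_def power_int_minus_left)

definition frak_S :: "int ^ 2 ^ 2 \<Rightarrow> int" where
  "frak_S A =
     (let a = A $ 1 $ 1; c = A $ 2 $ 1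
      in if c = 0 then 0
         else \<Sum>k = 1..\<bar>c\<bar> - 1.
                neg_one_power (\<lfloor>real_of_int (k * a) / real_of_int c\<rfloor> + k + 1))"

end

(* The value frak_S A depends only on the first column (a, c) of A; as a function of that column it
   is 2-periodic in the sense (a, c) -> (a + 2nc, c) and satisfies the reciprocity law
   S(a, c) + S(c, a) = sgn (a c).  For reciprocity, let a, c > 0 and follow the segment from (0, 0)
   to (c, a): the exponents floor (k a / c) + k and floor (k c / a) + k number its successive
   crossings with the vertical and the horizontal grid lines, so together they run exactly once
   through 1, ..., a + c - 2, and the alternating sum over this range is 1 because a + c is odd.
   The theorem follows by a Euclidean descent on the lower left entry of A, which replaces (a, c)
   by (-c, a + 2nc), the sign terms being matched by a cocycle identity. *)
theory Submission
  imports Defs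
begin

text \<open>This is the Hardy-Berndt sum, extended to negative \<open>c\<close>. For
  \<open>c = 0\<close> the range is empty, which gives the value 0 without a case split.\<close>

definition hardy_sum :: "int \<Rightarrow> int \<Rightarrow> int" where
  "hardy_sum a c = (\<Sum>k = 1..\<bar>c\<bar> - 1. neg_one_power (k * a div c + k + 1))"

lemma frak_S_eq_hardy_sum: "frak_S A = hardy_sum (A $ 1 $ 1) (A $ 2 $ 1)"
  by (simp add: frak_S_def hardy_sum_def Let_def floor_divide_of_int_eq flip: of_int_mult)

section \<open>Symmetries and periodicity of the sum\<close>

lemma hardy_sum_uminus_uminus: "hardy_sum (- a) (- c) = hardy_sum a c"
  by (simp add: hardy_sum_def)

lemma hardy_sum_add_even_multiple: "hardy_sum (a + 2 * n * c) c = hardy_sum a c"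
proof (cases "c = 0")
  case False
  have "k * (a + 2 * n * c) div c = k * a div c + 2 * (k * n)" for k
  proof -
    have "k * (a + 2 * n * c) = k * a + 2 * (k * n) * c"
      by (simp add: algebra_simps)
    then show ?thesis
      using False by simp
  qed
  then show ?thesis
    unfolding hardy_sum_def neg_one_power_def by simp
qed simp

lemma mult_mod_nonzero_of_coprime:
  fixes a c k :: int
  assumes "coprime a c" and "k \<in> {1..\<bar>c\<bar> - 1}"
  shows "k * a mod c \<noteq> 0"
proof
  assume "k * a mod c = 0"
  then have "c dvd k"
    using assms(1) by (metis coprime_commute coprime_dvd_mult_left_iff mod_0_imp_dvd)
  then have "\<bar>c\<bar> \<le> \<bar>k\<bar>"
    using assms(2) by (intro dvd_imp_le_int) auto
  then show False
    using assms(2) by auto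
qed

text \<open>Coprimality keeps \<open>k * a / c\<close> off the integers, so negating
  \<open>a\<close> sends the floor \<open>q\<close> to \<open>-q - 1\<close> and flips the parity of
  every exponent.\<close>

lemma hardy_sum_uminus_left:
  assumes "coprime a c"
  shows "hardy_sum (- a) c = - hardy_sum a c"
proof -
  have "neg_one_power (k * (- a) div c + k + 1) = - neg_one_power (k * a div c + k + 1)"
    if "k \<in> {1..\<bar>c\<bar> - 1}" for k
  proof -
    have "k * (- a) div c = - (k * a div c) - 1"
      using mult_mod_nonzero_of_coprime[OF assms that] that by (auto simp: zdiv_zminus1_eq_if)
    then show ?thesis
      by (simp add: neg_one_power_def)
  qed
  then show ?thesis
    by (simp add: hardy_sum_def sum_negf[symmetric] del: mult_minus_right)
qed

lemma hardy_sum_uminus_right: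
  assumes "coprime a c"
  shows "hardy_sum a (- c) = - hardy_sum a c"
  using hardy_sum_uminus_uminus[of "- a" c] hardy_sum_uminus_left[OF assms] by simp

section \<open>Grid crossings and the reciprocity law\<close>

lemma mult_div_bounds:
  fixes a c k :: int
  assumes "coprime a c" "0 < c" "k \<in> {1..c - 1}"
  shows "(k * a div c) * c < k * a" and "k * a < (k * a div c + 1) * c"
proof -
  have "k * a mod c \<noteq> 0"
    using assms by (intro mult_mod_nonzero_of_coprime) auto
  moreover have "0 \<le> k * a mod c" "k * a mod c < c"
    using assms(2) by auto
  moreover have "k * a = (k * a div c) * c + k * a mod c"
    by simp
  ultimately show "(k * a div c) * c < k * a" "k * a < (k * a div c + 1) * c"
    unfolding distrib_right by linarith+
qed

lemma crossing_index_mono: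
  fixes a c k l :: int
  assumes "0 < a" "0 < c" "k < l"
  shows "k * a div c + k < l * a div c + l"
proof -
  have "k * a div c \<le> l * a div c"
    using assms by (intro zdiv_mono1 mult_right_mono) auto
  then show ?thesis
    using assms by linarith
qed

lemma inj_on_crossing_index:
  fixes a c :: int
  assumes "0 < a" "0 < c"
  shows "inj_on (\<lambda>k. k * a div c + k) X"
  using crossing_index_mono[OF assms] by (intro linorder_inj_onI) (auto simp: less_le)

lemma crossing_index_range:
  fixes a c :: int
  assumes "coprime a c" "0 < a" "0 < c" "k \<in> {1..c - 1}"
  shows "k * a div c + k \<in> {1..a + c - 2}"
proof -
  have "(k * a div c) * c < k * a"
    using mult_div_bounds(1) assms by blast
  also have "\<dots> < a * c"
    using assms by (simp add: mult.commute)
  finally have "k * a div c < a"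
    using assms(3) by simp
  moreover have "0 \<le> k * a div c"
    using assms by (simp add: pos_imp_zdiv_nonneg_iff)
  ultimately show ?thesis
    using assms(4) by auto
qed

lemma crossing_indices_distinct:
  fixes a c k l :: int
  assumes "coprime a c" "0 < a" "0 < c" "k \<in> {1..c - 1}" "l \<in> {1..a - 1}"
  shows "k * a div c + k \<noteq> l * c div a + l"
proof
  define m n where "m = k * a div c" and "n = l * c div a"
  assume "k * a div c + k = l * c div a + l"
  then have eq: "m + k = n + l"
    by (simp add: m_def n_def)
  have m: "m * c < k * a" "k * a < (m + 1) * c"
    using mult_div_bounds[of a c k] assms by (auto simp: m_def)
  have n: "n * a < l * c" "l * c < (n + 1) * a"
    using mult_div_bounds[of c a l] assms by (auto simp: n_def coprime_commute)
  \<comment> \<open>By \<open>eq\<close>, \<open>l \<le> m\<close> is equivalent to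
    \<open>k \<le> n\<close>. The first says that y = l is crossed before x = k, the second says the
    reverse; the negations contradict each other in the same way.\<close>
  show False
  proof (cases "l \<le> m")
    case True
    then have "l * c \<le> m * c" "k * a \<le> n * a"
      using eq assms by (auto intro!: mult_right_mono)
    then show False
      using m n by linarith
  next
    case False
    then have "(m + 1) * c \<le> l * c" "(n + 1) * a \<le> k * a"
      using eq assms by (auto intro!: mult_right_mono)
    then show False
      using m n by linarith
  qed
qed

lemma sum_alternating:
  "(\<Sum>j = 1..2 * int n + 1. neg_one_power (j + 1)) = 1"
proof (induction n)
  case 0
  then show ?case
    by (simp add: neg_one_power_def)
next
  case (Suc n)
  have "{1..2 * int (Suc n) + 1} = insert (2 * int n + 3) (insert (2 * int n + 2) {1..2 * int n + 1})"
    by auto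
  then show ?case
    using Suc by (simp add: neg_one_power_def)
qed

lemma hardy_sum_reciprocity_pos:
  assumes "coprime a c" "odd (a + c)" "0 < a" "0 < c"
  shows "hardy_sum a c + hardy_sum c a = 1"
proof -
  define f where "f k = k * a div c + k" for k
  define g where "g k = k * c div a + k" for k
  let ?F = "f ` {1..c - 1}" and ?G = "g ` {1..a - 1}"
  have inj: "inj_on f {1..c - 1}" "inj_on g {1..a - 1}"
    unfolding f_def g_def using assms by (auto intro: inj_on_crossing_index)
  have disj: "?F \<inter> ?G = {}"
    using crossing_indices_distinct[OF assms(1,3,4)] by (auto simp: f_def g_def)
  have sub: "?F \<union> ?G \<subseteq> {1..a + c - 2}"
    using crossing_index_range[of a c] crossing_index_range[of c a] assms
    by (auto simp: f_def g_def coprime_commute add.commute)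
  \<comment> \<open>Injectivity and disjointness give (c - 1) + (a - 1) indices, exactly the size of
    the interval, so the inclusion \<open>sub\<close> is an equality.\<close>
  have "card (?F \<union> ?G) = card {1..a + c - 2}"
    using assms disj by (simp add: card_Un_disjoint card_image inj flip: nat_add_distrib)
  then have un: "?F \<union> ?G = {1..a + c - 2}"
    using sub by (intro card_subset_eq) auto
  obtain m where m: "a + c = 2 * m + 1"
    using assms(2) by (rule oddE)
  have "hardy_sum a c + hardy_sum c a
      = (\<Sum>j\<in>?F. neg_one_power (j + 1)) + (\<Sum>j\<in>?G. neg_one_power (j + 1))"
    using assms(3,4) by (simp add: hardy_sum_def sum.reindex inj) (simp add: f_def g_def)
  also have "\<dots> = (\<Sum>j = 1..a + c - 2. neg_one_power (j + 1))"
    by (simp add: sum.union_disjoint disj flip: un)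
  \<comment> \<open>Here a + c - 2 = 2 (m - 1) + 1 is odd, so one term +1 survives the
    cancellation.\<close>
  also have "\<dots> = 1"
    using sum_alternating[of "nat (m - 1)"] m assms(3,4) by (simp add: algebra_simps)
  finally show ?thesis .
qed

lemma hardy_sum_reciprocity:
  assumes "coprime a c" "odd (a + c)"
  shows "hardy_sum a c + hardy_sum c a = sgn (a * c)"
proof (cases "a = 0 \<or> c = 0")
  case True
  \<comment> \<open>Coprimality forces the other entry to be 1 or -1, so both sums are
    empty.\<close>
  then show ?thesis
    using assms(1) by (auto simp: hardy_sum_def)
next
  case False
  \<comment> \<open>Both sums are odd in each argument, so the signs can be pulled out of the
    positive case.\<close>
  have "hardy_sum (\<bar>a\<bar>) (\<bar>c\<bar>) + hardy_sum (\<bar>c\<bar>) (\<bar>a\<bar>) = 1"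
    using assms False by (intro hardy_sum_reciprocity_pos) auto
  moreover have "coprime c a"
    using assms(1) by (simp add: coprime_commute)
  ultimately show ?thesis
    using False assms(1)
    by (cases "a > 0"; cases "c > 0")
       (auto simp: hardy_sum_uminus_left hardy_sum_uminus_right hardy_sum_uminus_uminus
          sgn_mult abs_if not_less le_less)
qed

lemma hardy_sum_rotate:
  assumes "coprime a c" "odd (a + c)"
  shows "hardy_sum (- c) a = hardy_sum a c - sgn (a * c)"
  using hardy_sum_reciprocity[OF assms] hardy_sum_uminus_left[of c a] assms(1)
  by (simp add: coprime_commute)

section \<open>Sign cocycle and Euclidean descent\<close>

lemma sgn_cocycle:
  fixes x y u v :: int
  assumes "x \<noteq> 0 \<or> y \<noteq> 0" "u \<noteq> 0 \<or> v \<noteq> 0" and w: "w = x * v - y * u"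
  shows "sgn (x * y) - sgn (u * v) = sgn (y * w * v) - sgn (x * w * u)"
proof -
  have sgn_diff: "sgn (p - q) = sgn p" if "sgn q = 0 \<or> sgn q = - sgn p" for p q :: int
    using that by (auto simp: sgn_if split: if_splits)
  have "sgn w = sgn (x * v)" if "sgn (y * u) = 0 \<or> sgn (y * u) = - sgn (x * v)"
    using sgn_diff[OF that] w by simp
  moreover have "sgn w = - sgn (y * u)" if "sgn (x * v) = 0"
    using that w by (auto simp: sgn_0_0)
  \<comment> \<open>The facts above leave the sign of \<open>w\<close> open only when
    \<open>x * v\<close> and \<open>y * u\<close> are nonzero of equal sign. Then
    \<open>x * y\<close> and \<open>u * v\<close> agree in sign, as do \<open>y * v\<close> and
    \<open>x * u\<close>, so both sides vanish whatever \<open>w\<close> is.\<close>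
  ultimately show ?thesis
    using assms(1,2) unfolding sgn_mult
    by (cases x "0::int" rule: linorder_cases; cases y "0::int" rule: linorder_cases;
        cases u "0::int" rule: linorder_cases; cases v "0::int" rule: linorder_cases; simp)
qed

lemma even_multiple_remainder:
  fixes a c :: int
  assumes "c \<noteq> 0" "odd (a + c)"
  obtains n where "\<bar>a + 2 * n * c\<bar> < \<bar>c\<bar>"
proof -
  \<comment> \<open>Shifting by \<open>c\<close> centres the remainder: \<open>r - c\<close> lies
    between -|c| and |c|, and the endpoint \<open>-c\<close> is excluded because \<open>r\<close> is
    odd.\<close>
  define r where "r = (a + c) mod (2 * c)"
  have r: "a + c = 2 * c * ((a + c) div (2 * c)) + r"
    by (simp add: r_def)
  then have "odd r"
    using assms(2) by (metis dvd_triv_left even_add mult.assoc)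
  then have "r \<noteq> 0"
    by auto
  have "\<bar>r - c\<bar> < \<bar>c\<bar>"
  proof (cases "c > 0")
    case True
    then have "0 \<le> r" "r < 2 * c"
      by (auto simp: r_def)
    then show ?thesis
      using True \<open>r \<noteq> 0\<close> by linarith
  next
    case False
    then have "r \<le> 0" "2 * c < r"
      using assms(1) by (auto simp: r_def)
    then show ?thesis
      using False \<open>r \<noteq> 0\<close> by linarith
  qed
  moreover have "a + 2 * (- ((a + c) div (2 * c))) * c = r - c"
    using r by (simp add: algebra_simps)
  ultimately show ?thesis
    using that by metis
qed

lemma coprime_of_det_eq_1:
  fixes a b c d :: int
  assumes "a * d - b * c = 1"
  shows "coprime a c"
proof (rule coprimeI)
  fix e
  assume "e dvd a" "e dvd c"
  then have "e dvd a * d - b * c"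
    by simp
  then show "is_unit e"
    using assms by simp
qed

text \<open>The inverse matrix expresses \<open>p\<close> and \<open>q\<close> through the entries
  of the image, so common divisors of the image divide both.\<close>

lemma coprime_mult_vector:
  fixes a b c d p q :: int
  assumes det: "a * d - b * c = 1" and "coprime p q"
  shows "coprime (a * p + b * q) (c * p + d * q)"
proof (rule coprimeI)
  fix e
  assume e: "e dvd a * p + b * q" "e dvd c * p + d * q"
  have "p = d * (a * p + b * q) - b * (c * p + d * q)"
    using det by algebra
  moreover have "q = a * (c * p + d * q) - c * (a * p + b * q)"
    using det by algebra
  ultimately have "e dvd p" "e dvd q"
    using e by (metis dvd_diff dvd_mult)+
  then show "is_unit e"
    using assms(2) coprime_common_divisor by blast
qed

text \<open>Only the first column \<open>(p, q)\<close> of the right factor matters; it stays fixed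
  while the left factor is reduced. Odd column sums are the form of the parity condition that even
  row shifts and row swaps visibly preserve.\<close>

lemma hardy_sum_mult_vector:
  fixes a b c d p q :: int
  assumes "a * d - b * c = 1" "odd (a + c)" "odd (b + d)" and pq: "coprime p q" "odd (p + q)"
  shows "hardy_sum (a * p + b * q) (c * p + d * q) - hardy_sum a c - hardy_sum p q
    = - sgn (c * q * (c * p + d * q))"
  using assms(1-3)
proof (induction "nat \<bar>c\<bar>" arbitrary: a b c d rule: less_induct)
  case less
  note det = less.prems(1) and odd = less.prems(2,3)
  define V where "V = c * p + d * q"
  show ?case
  proof (cases "c = 0")
    case True
    \<comment> \<open>The left factor is, up to sign, a translation by the even number
      \<open>b\<close> or \<open>-b\<close>, and the sum is invariant under it.\<close>
    then have "a * d = 1"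
      using det by simp
    then have unit: "a = 1 \<and> d = 1 \<or> a = - 1 \<and> d = - 1"
      by (simp add: zmult_eq_1_iff)
    then have "even b"
      using odd(2) by auto
    then obtain m where b: "b = 2 * m"
      by (rule evenE)
    have "hardy_sum (a * p + b * q) (d * q) = hardy_sum p q"
      using unit
    proof
      assume "a = 1 \<and> d = 1"
      then show ?thesis
        using hardy_sum_add_even_multiple[of p m q] by (simp add: b)
    next
      assume "a = - 1 \<and> d = - 1"
      then show ?thesis
        using hardy_sum_add_even_multiple[of p "- m" q]
          hardy_sum_uminus_uminus[of "p + 2 * (- m) * q" q]
        by (simp add: b)
    qed
    then show ?thesis
      by (simp add: True hardy_sum_def[of _ 0])
  next
    case False
    obtain n where n: "\<bar>a + 2 * n * c\<bar> < \<bar>c\<bar>"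
      using even_multiple_remainder[OF False odd(1)] .
    define r s where "r = a + 2 * n * c" and "s = b + 2 * n * d"
    define U where "U = r * p + s * q"
    have det': "r * d - s * c = 1"
      using det by (simp add: r_def s_def algebra_simps)
    have odd': "odd (r + c)" "odd (s + d)"
      using odd by (auto simp: r_def s_def)
    have cop: "coprime r c" "coprime U V"
      unfolding U_def V_def using det' pq(1) by (auto intro: coprime_of_det_eq_1 coprime_mult_vector)
    have oddUV: "odd (U + V)"
    proof -
      have "U + V = (r + c) * p + (s + d) * q"
        by (simp add: U_def V_def algebra_simps)
      then show ?thesis
        using odd' pq(2) by auto
    qed
    \<comment> \<open>Induction hypothesis for the matrix with rows \<open>(-c, -d)\<close> and
      \<open>(r, s)\<close>, whose lower left entry satisfies |r| < |c|.\<close>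
    have "hardy_sum ((- c) * p + (- d) * q) (r * p + s * q) - hardy_sum (- c) r - hardy_sum p q
      = - sgn (r * q * (r * p + s * q))"
      using det' odd' n by (intro less.hyps) (auto simp: r_def algebra_simps)
    then have "hardy_sum (- V) U - hardy_sum (- c) r - hardy_sum p q = - sgn (r * q * U)"
      by (simp add: U_def V_def)
    then have "hardy_sum U V - sgn (U * V) - (hardy_sum r c - sgn (r * c)) - hardy_sum p q
      = - sgn (r * q * U)"
      using hardy_sum_rotate[OF cop(1) odd'(1)] hardy_sum_rotate[OF cop(2) oddUV] by simp
    \<comment> \<open>The columns \<open>(r, c)\<close> and \<open>(U, V)\<close> have determinant
      \<open>(r * d - s * c) * q = q\<close>, which takes the place of \<open>w\<close> in the
      cocycle identity.\<close>
    moreover have "sgn (r * c) - sgn (U * V) = sgn (c * q * V) - sgn (r * q * U)"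
    proof (rule sgn_cocycle)
      show "q = r * V - c * U"
        unfolding U_def V_def using det' by algebra
    qed (use cop False in auto)
    moreover have "hardy_sum r c = hardy_sum a c"
      by (simp add: r_def hardy_sum_add_even_multiple)
    moreover have "hardy_sum U V = hardy_sum (a * p + b * q) V"
    proof -
      have "U = (a * p + b * q) + 2 * n * V"
        by (simp add: U_def V_def r_def s_def algebra_simps)
      then show ?thesis
        by (simp add: hardy_sum_add_even_multiple)
    qed
    ultimately show ?thesis
      unfolding V_def by linarith
  qed
qed

section \<open>Passage to the theta group\<close>

lemma Gamma_thetaD:
  assumes "A \<in> Gamma_theta"
  shows "A $ 1 $ 1 * A $ 2 $ 2 - A $ 1 $ 2 * A $ 2 $ 1 = 1"
    and "odd (A $ 1 $ 1 + A $ 2 $ 1)" and "odd (A $ 1 $ 2 + A $ 2 $ 2)"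
proof -
  have par: "even (A $ 1 $ 1) = even (A $ 2 $ 2)" "even (A $ 1 $ 2) = even (A $ 2 $ 1)"
    using assms by (auto simp: Gamma_theta_def cong_def even_iff_mod_2_eq_zero)
  show det: "A $ 1 $ 1 * A $ 2 $ 2 - A $ 1 $ 2 * A $ 2 $ 1 = 1"
    using assms by (simp add: Gamma_theta_def det_2)
  \<comment> \<open>With equal parities along both diagonals, an odd determinant means that exactly
    one diagonal is odd, so each column has one odd entry.\<close>
  then have "odd (A $ 1 $ 1 * A $ 2 $ 2 - A $ 1 $ 2 * A $ 2 $ 1)"
    by simp
  then show "odd (A $ 1 $ 1 + A $ 2 $ 1)" "odd (A $ 1 $ 2 + A $ 2 $ 2)"
    using par by auto
qed

theorem theorem6:
  fixes A B :: "int ^ 2 ^ 2"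
  assumes "A \<in> Gamma_theta" and "B \<in> Gamma_theta"
  shows "frak_S (A ** B) - frak_S A - frak_S B
           = - sgn (A $ 2 $ 1 * B $ 2 $ 1 * (A ** B) $ 2 $ 1)"
  using hardy_sum_mult_vector[OF Gamma_thetaD[OF assms(1)]
      coprime_of_det_eq_1[OF Gamma_thetaD(1)[OF assms(2)]] Gamma_thetaD(2)[OF assms(2)]]
  by (simp add: frak_S_eq_hardy_sum matrix_matrix_mult_def sum_2)

end
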